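(* Let $m\ge1$ be an integer. Let $L=\{(0,0),(0,1),(1,0),(3,3)\}$, $L_1=\{(0,0),(0,1),(1,0)\}$ and $L_2=\{(3,3)\}$, all subsets of $\mathbb{Z}_4^2$, and let $S=T=\prod_{j=1}^m L\subset\mathbb{Z}_4^{2m}$. For $0\le i\le m$, let $E_{m,i}$ be the union of all products $\prod_{j=1}^m N_j\subset\mathbb{Z}_4^{2m}$ with $N_j\in\{L_1,L_2\}$ such that exactly $i$ indices $j$ satisfy $N_j=L_1$ and exactly $m-i$ indices satisfy $N_j=L_2$. Define $$S_0=\begin{cases}\bigcup_{i=0}^{(m-1)/2}E_{m,2i+1}& m\text{ odd},\\ \bigcup_{i=0}^{m/2}E_{m,2i}& m\text{ even},\end{cases}\qquad S_1=\begin{cases}\bigcup_{i=0}^{(m-1)/2}E_{m,2i}& m\text{ odd},\\ \bigcup_{i=0}^{m/2-1}E_{m,2i+1}& m\text{ even},\end{cases}$$ which form a partition of $S$. Let $$S'=\{(0,x)\mid x\in S_0\}\cup\{(1,x)\mid x\in S_1\},\qquad T'=\{(0,x)\mid x\in T\}\cup\{(1,x)\mid x\in T^{(-1)}\}.$$ Then $S'$ and $T'$ form a primitive formally dual pair in $\mathbb{Z}_2\times\mathbb{Z}_4^{2m}$ (under the canonical isomorphism $(w,z)\mapsto\phi_{w,z}$). Moreover, $$\theta(T',\mathbb{Z}_2\times\mathbb{Z}_4^{2m})=2^{4m+1}-13^m-10^m.$$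
   Context: The group operation in $\mathbb{Z}_2\times\mathbb{Z}_4^{2m}$ is componentwise addition; for a subset $A$ of a finite abelian group $G$ (written additively), $A^{(-1)}=\{-a\mid a\in A\}$, $\nu_A(y)=|\{(a_1,a_2)\in A\times A\mid y=a_1-a_2\}|$, $\chi(A)=\sum_{a\in A}\chi(a)$ for a character $\chi$ of $G$, and $\theta(A,G)$ is the number of $g\in G$ with $\nu_A(g)=0$ (the frequency of $0$ in the difference spectrum of $A$). Formally dual pair: given an isomorphism $\Delta:G\to\widehat G$, $\Delta(y)=\chi_y$, subsets $S,T$ of $G$ form a formally dual pair under $\Delta$ if $|\chi_y(S)|^2=\frac{|S|^2}{|T|}\nu_T(y)$ for each $y\in G$. A subset of $G$ is primitive if it is not contained in a coset of a proper subgroup of $G$ and is not a union of cosets of a nontrivial subgroup of $G$; a formally dual pair is primitive if both subsets are primitive. Canonical isomorphism for $\mathbb{Z}_2\times\mathbb{Z}_4^n$: $(w,z)\mapsto\phi_{w,z}$ with $\phi_{w,z}((a,b))=(-1)^{wa}(\sqrt{-1})^{z\cdot b}$, where $z\cdot b=\sum_{i=1}^n z_ib_i$. *)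

theory Defs
  imports Complex_Main "HOL-Algebra.Elementary_Groups" "HOL-Algebra.Product_Groups"
begin

section \<open>Characters and formally dual pairs\<close>

definition nonzero_complex_group :: "complex monoid" where
  "nonzero_complex_group = \<lparr>carrier = - {0}, mult = (*), one = 1\<rparr>"

text \<open>Characters are required to be \<open>undefined\<close> off \<^term>\<open>carrier G\<close>, so that each character is
  represented by exactly one function and a bijection onto the dual group is meaningful.\<close>

definition dual_group :: "('a, 'b) monoid_scheme \<Rightarrow> ('a \<Rightarrow> complex) monoid" where
  "dual_group G =
    \<lparr>carrier = hom G nonzero_complex_group \<inter> extensional (carrier G),
     mult = (\<lambda>f g. \<lambda>x\<in>carrier G. f x * g x),
     one = (\<lambda>x\<in>carrier G. 1)\<rparr>"

definition char_sum :: "('a \<Rightarrow> complex) \<Rightarrow> 'a set \<Rightarrow> complex" where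
  "char_sum \<chi> A = (\<Sum>a\<in>A. \<chi> a)"

definition diff_count :: "('a, 'b) monoid_scheme \<Rightarrow> 'a set \<Rightarrow> 'a \<Rightarrow> nat" where
  "diff_count G A y = card {(a1, a2). (a1, a2) \<in> A \<times> A \<and> y = a1 \<otimes>\<^bsub>G\<^esub> inv\<^bsub>G\<^esub> a2}"

definition zero_frequency :: "('a, 'b) monoid_scheme \<Rightarrow> 'a set \<Rightarrow> nat" where
  "zero_frequency G A = card {g \<in> carrier G. diff_count G A g = 0}"

text \<open>\<open>T \<noteq> {}\<close> is what the quotient \<open>|S|\<^sup>2 / |T|\<close> presupposes.\<close>

definition formally_dual_pair ::
  "('a, 'b) monoid_scheme \<Rightarrow> ('a \<Rightarrow> 'a \<Rightarrow> complex) \<Rightarrow> 'a set \<Rightarrow> 'a set \<Rightarrow> bool" where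
  "formally_dual_pair G \<Delta> S T \<longleftrightarrow>
     comm_group G \<and> finite (carrier G) \<and> \<Delta> \<in> iso G (dual_group G) \<and>
     S \<subseteq> carrier G \<and> T \<subseteq> carrier G \<and> T \<noteq> {} \<and>
     (\<forall>y\<in>carrier G. (cmod (char_sum (\<Delta> y) S))\<^sup>2 =
        (real (card S))\<^sup>2 / real (card T) * real (diff_count G T y))"

definition primitive_subset :: "('a, 'b) monoid_scheme \<Rightarrow> 'a set \<Rightarrow> bool" where
  "primitive_subset G A \<longleftrightarrow>
     A \<subseteq> carrier G \<and>
     \<not> (\<exists>H. subgroup H G \<and> H \<noteq> carrier G \<and> (\<exists>C \<in> rcosets\<^bsub>G\<^esub> H. A \<subseteq> C)) \<and>
     \<not> (\<exists>H. subgroup H G \<and> H \<noteq> {\<one>\<^bsub>G\<^esub>} \<and> (\<exists>\<C> \<subseteq> rcosets\<^bsub>G\<^esub> H. A = \<Union>\<C>))"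

definition primitive_formally_dual_pair ::
  "('a, 'b) monoid_scheme \<Rightarrow> ('a \<Rightarrow> 'a \<Rightarrow> complex) \<Rightarrow> 'a set \<Rightarrow> 'a set \<Rightarrow> bool" where
  "primitive_formally_dual_pair G \<Delta> S T \<longleftrightarrow>
     formally_dual_pair G \<Delta> S T \<and> primitive_subset G S \<and> primitive_subset G T"


section \<open>The groups \<open>\<int>\<^sub>4\<^sup>n\<close> and \<open>\<int>\<^sub>2 \<times> \<int>\<^sub>4\<^sup>n\<close>\<close>

text \<open>Coordinates are indexed from \<open>0\<close>; residues are the integers \<open>0, 1\<close> and \<open>0, 1, 2, 3\<close>.\<close>

definition Z4_power :: "nat \<Rightarrow> (nat \<Rightarrow> int) monoid" where
  "Z4_power n = product_group {..<n} (\<lambda>_. integer_mod_group 4)"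

definition Z2_Z4_power :: "nat \<Rightarrow> (int \<times> (nat \<Rightarrow> int)) monoid" where
  "Z2_Z4_power n = integer_mod_group 2 \<times>\<times> Z4_power n"

definition canonical_iso ::
  "nat \<Rightarrow> int \<times> (nat \<Rightarrow> int) \<Rightarrow> int \<times> (nat \<Rightarrow> int) \<Rightarrow> complex" where
  "canonical_iso n = (\<lambda>(w, z). \<lambda>(a, b)\<in>carrier (Z2_Z4_power n).
     (-1) powi (w * a) * \<i> powi (\<Sum>i<n. z i * b i))"


section \<open>The construction\<close>

definition L1 :: "(int \<times> int) set" where "L1 = {(0, 0), (0, 1), (1, 0)}"
definition L2 :: "(int \<times> int) set" where "L2 = {(3, 3)}"
definition L :: "(int \<times> int) set" where "L = {(0, 0), (0, 1), (1, 0), (3, 3)}"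

text \<open>The product \<open>N\<^sub>0 \<times> \<dots> \<times> N\<^bsub>m-1\<^esub>\<close> of subsets of \<open>\<int>\<^sub>4\<^sup>2\<close> inside \<open>\<int>\<^sub>4\<^bsup>2m\<^esup>\<close>:
  the \<open>j\<close>-th factor occupies the coordinates \<open>2j\<close> and \<open>2j + 1\<close>.\<close>

definition block_prod :: "nat \<Rightarrow> (nat \<Rightarrow> (int \<times> int) set) \<Rightarrow> (nat \<Rightarrow> int) set" where
  "block_prod m N = {x \<in> carrier (Z4_power (2 * m)). \<forall>j<m. (x (2 * j), x (2 * j + 1)) \<in> N j}"

definition S_set :: "nat \<Rightarrow> (nat \<Rightarrow> int) set" where
  "S_set m = block_prod m (\<lambda>_. L)"

definition T_set :: "nat \<Rightarrow> (nat \<Rightarrow> int) set" where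
  "T_set m = block_prod m (\<lambda>_. L)"

definition E_set :: "nat \<Rightarrow> nat \<Rightarrow> (nat \<Rightarrow> int) set" where
  "E_set m i = \<Union> {block_prod m N | N. (\<forall>j<m. N j \<in> {L1, L2}) \<and>
     card {j. j < m \<and> N j = L1} = i \<and> card {j. j < m \<and> N j = L2} = m - i}"

definition S0 :: "nat \<Rightarrow> (nat \<Rightarrow> int) set" where
  "S0 m = (if odd m then \<Union>i\<in>{0..(m - 1) div 2}. E_set m (2 * i + 1)
           else \<Union>i\<in>{0..m div 2}. E_set m (2 * i))"

definition S1 :: "nat \<Rightarrow> (nat \<Rightarrow> int) set" where
  "S1 m = (if odd m then \<Union>i\<in>{0..(m - 1) div 2}. E_set m (2 * i)
           else \<Union>i\<in>{0..<m div 2}. E_set m (2 * i + 1))"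

definition S' :: "nat \<Rightarrow> (int \<times> (nat \<Rightarrow> int)) set" where
  "S' m = {(0, x) | x. x \<in> S0 m} \<union> {(1, x) | x. x \<in> S1 m}"

definition T' :: "nat \<Rightarrow> (int \<times> (nat \<Rightarrow> int)) set" where
  "T' m = {(0, x) | x. x \<in> T_set m} \<union> {(1, x) | x. x \<in> set_inv\<^bsub>Z4_power (2 * m)\<^esub> (T_set m)}"

end

theory Submission
  imports Defs
begin

text \<open>
  Both sets decompose blockwise over the \<open>m\<close> factors \<open>\<int>\<^sub>4\<^sup>2\<close>, so formal duality and the frequency of
  zero reduce to finite checks on \<open>\<int>\<^sub>4\<^sup>2\<close>. Writing \<open>twist m x\<close> for the number of blocks of \<open>x\<close>
  equal to \<open>(3, 3)\<close>, the set \<open>S'\<close> is \<open>{(twist m x mod 2, x) | x \<in> S}\<close>, because \<open>S0\<close> and \<open>S1\<close> collect the \<open>x\<close> of even and odd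
  twist (\<open>S0_eq\<close>, \<open>S1_eq\<close>). The sign \<open>(-1)\<close> to the power \<open>w * twist m x\<close> is a product of block
  signs, so the character sum of \<open>S'\<close> at \<open>(w, z)\<close> is the product over the blocks \<open>u\<close> of \<open>z\<close> of the
  character sum of \<open>L\<close> at \<open>u\<close>, in which the term of \<open>(3, 3)\<close> is negated if \<open>w = 1\<close>
  (\<open>char_sum_S'\<close>).

  Similarly \<open>T'\<close> consists of \<open>{0} \<times> L\<^sup>m\<close> and \<open>{1} \<times> (-L)\<^sup>m\<close>. The number of representations of
  \<open>(0, z)\<close> as a difference is twice the product of the numbers of representations of the blocks of
  \<open>z\<close> as differences of elements of \<open>L\<close>; for \<open>(1, z)\<close> sums of two elements of \<open>L\<close> take the place of
  differences (\<open>diff_count_T'\<close>). Formal duality then follows from two identities on \<open>\<int>\<^sub>4\<^sup>2\<close>: the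
  squared absolute value of the plain (respectively twisted) character sum of \<open>L\<close> at \<open>u\<close> is four
  times the number of representations of \<open>u\<close> as a difference (respectively sum) of two elements of
  \<open>L\<close> (\<open>L_phase_sum\<close>, \<open>L_twisted_phase_sum\<close>). The frequency of zero follows since \<open>L - L\<close> has
  \<open>13\<close> elements and \<open>L + L\<close> has \<open>10\<close>.

  For primitivity, both sets contain \<open>0\<close>, all \<open>(0, e\<^sub>i)\<close>, and an element with first component \<open>1\<close>,
  and these generate the group. A subgroup of whose cosets one of the sets is a union would lie in
  that set, but doubling an element of the set whose second component is nonzero leaves the set;
  the only remaining candidate for a nontrivial element of such a subgroup is \<open>(1, 0)\<close>, which does
  not belong to \<open>S'\<close> and is not a period of \<open>T'\<close> because \<open>L\<close> differs from \<open>-L\<close>.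
\<close>

section \<open>The ambient groups\<close>

lemma carrier_Z4_power: "carrier (Z4_power n) = ({..<n} \<rightarrow>\<^sub>E {0..<4})"
  by (simp add: Z4_power_def carrier_integer_mod_group)

lemma mult_Z4_power: "x \<otimes>\<^bsub>Z4_power n\<^esub> y = (\<lambda>i\<in>{..<n}. (x i + y i) mod 4)"
  by (simp add: Z4_power_def)

lemma one_Z4_power: "\<one>\<^bsub>Z4_power n\<^esub> = (\<lambda>i\<in>{..<n}. 0)"
  by (simp add: Z4_power_def)

lemma inv_Z4_power:
  assumes "x \<in> carrier (Z4_power n)"
  shows "inv\<^bsub>Z4_power n\<^esub> x = (\<lambda>i\<in>{..<n}. (- x i) mod 4)"
proof -
  have "inv\<^bsub>Z4_power n\<^esub> x = (\<lambda>i\<in>{..<n}. inv\<^bsub>integer_mod_group 4\<^esub> (x i))"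
    using assms unfolding Z4_power_def by (subst inv_product_group) auto
  also have "\<dots> = (\<lambda>i\<in>{..<n}. (- x i) mod 4)"
  proof (rule restrict_ext)
    fix i assume "i \<in> {..<n}"
    then have "x i \<in> carrier (integer_mod_group 4)"
      using assms by (auto simp: Z4_power_def)
    then show "inv\<^bsub>integer_mod_group 4\<^esub> (x i) = (- x i) mod 4"
      by simp
  qed
  finally show ?thesis .
qed

lemma group_Z4_power: "group (Z4_power n)"
  by (simp add: Z4_power_def)

lemma finite_Z4_power: "finite (carrier (Z4_power n))"
  by (simp add: carrier_Z4_power finite_PiE)

lemma card_Z4_power: "card (carrier (Z4_power n)) = 4 ^ n"
  by (simp add: carrier_Z4_power card_PiE)

lemma carrier_Z2_Z4_power:
  "carrier (Z2_Z4_power n) = {0, 1} \<times> carrier (Z4_power n)"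
  by (auto simp: Z2_Z4_power_def carrier_integer_mod_group)

lemma mult_Z2_Z4_power:
  "(a, x) \<otimes>\<^bsub>Z2_Z4_power n\<^esub> (b, y) = ((a + b) mod 2, x \<otimes>\<^bsub>Z4_power n\<^esub> y)"
  by (simp add: Z2_Z4_power_def)

lemma one_Z2_Z4_power: "\<one>\<^bsub>Z2_Z4_power n\<^esub> = (0, \<one>\<^bsub>Z4_power n\<^esub>)"
  by (simp add: Z2_Z4_power_def)

lemma comm_group_Z2_Z4_power: "comm_group (Z2_Z4_power n)"
proof (rule group.group_comm_groupI)
  show "group (Z2_Z4_power n)"
    unfolding Z2_Z4_power_def by (intro DirProd_group group_Z4_power) simp
qed (auto simp: Z2_Z4_power_def mult_Z4_power add.commute)

lemma group_Z2_Z4_power: "group (Z2_Z4_power n)"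
  using comm_group_Z2_Z4_power by (rule comm_group.axioms(2))

lemma inv_Z2_Z4_power:
  assumes "a \<in> {0, 1}" "x \<in> carrier (Z4_power n)"
  shows "inv\<^bsub>Z2_Z4_power n\<^esub> (a, x) = (a, inv\<^bsub>Z4_power n\<^esub> x)"
proof -
  have "a \<in> carrier (integer_mod_group 2)"
    using assms by (auto simp: carrier_integer_mod_group)
  then show ?thesis
    using assms unfolding Z2_Z4_power_def
    by (subst inv_DirProd) (auto simp: group_Z4_power)
qed

lemma finite_Z2_Z4_power: "finite (carrier (Z2_Z4_power n))"
  by (simp add: carrier_Z2_Z4_power finite_Z4_power)

text \<open>The standard basis vector \<open>e\<^sub>i\<close> of \<open>\<int>\<^sub>4\<^sup>n\<close>; it is the zero vector if \<open>i \<ge> n\<close>.\<close>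

definition unit_vec :: "nat \<Rightarrow> nat \<Rightarrow> nat \<Rightarrow> int" where
  "unit_vec n i = (\<lambda>k\<in>{..<n}. if k = i then 1 else 0)"

lemma unit_vec_carrier: "unit_vec n i \<in> carrier (Z4_power n)"
  by (auto simp: unit_vec_def carrier_Z4_power)

lemma zero_carrier: "(\<lambda>i\<in>{..<n}. 0) \<in> carrier (Z4_power n)"
  by (auto simp: carrier_Z4_power)

text \<open>The basis vectors generate \<open>{0} \<times> \<int>\<^sub>4\<^sup>n\<close>, which has index two, so any one element outside it
  completes a generating set.\<close>

lemma Z2_Z4_power_generated:
  assumes H: "subgroup H (Z2_Z4_power n)"
    and units: "\<And>i. i < n \<Longrightarrow> (0, unit_vec n i) \<in> H"
    and x: "(1, x) \<in> H"
  shows "H = carrier (Z2_Z4_power n)"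
proof -
  have zero: "(0, \<lambda>i\<in>{..<n}. 0) \<in> H"
    using subgroup.one_closed[OF H] by (simp add: one_Z2_Z4_power one_Z4_power)
  have mult: "(a, \<lambda>i\<in>{..<n}. (u i + v i) mod 4) \<in> H"
    if "(a, u) \<in> H" "(0, v) \<in> H" "a \<in> {0, 1}" for a u v
    using subgroup.m_closed[OF H that(1,2)] that(3) by (auto simp: mult_Z2_Z4_power mult_Z4_power)
  have multiple: "(0, \<lambda>k\<in>{..<n}. if k = i then int c mod 4 else 0) \<in> H" if "i < n" for i c
  proof (induction c)
    case 0
    have "(\<lambda>k\<in>{..<n}. if k = i then int 0 mod 4 else 0) = (\<lambda>k\<in>{..<n}. 0)"
      by auto
    then show ?case using zero by metis
  next
    case (Suc c)
    have eq: "(\<lambda>k\<in>{..<n}. ((\<lambda>k\<in>{..<n}. if k = i then int c mod 4 else 0) k + unit_vec n i k) mod 4)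
        = (\<lambda>k\<in>{..<n}. if k = i then int (Suc c) mod 4 else 0)"
      by (rule restrict_ext) (auto simp: unit_vec_def mod_simps add.commute)
    show ?case using mult[OF Suc units[OF that]] unfolding eq by blast
  qed
  \<comment> \<open>Assemble a vector coordinate by coordinate.\<close>
  have partial: "(0, \<lambda>i\<in>{..<n}. if i < k then b i else 0) \<in> H"
    if b: "b \<in> carrier (Z4_power n)" and "k \<le> n" for b k
    using \<open>k \<le> n\<close>
  proof (induction k)
    case 0
    have "(\<lambda>i\<in>{..<n}. if i < 0 then b i else 0) = (\<lambda>i\<in>{..<n}. 0)"
      by auto
    then show ?case using zero by metis
  next
    case (Suc k)
    have bnd: "0 \<le> b i \<and> b i < 4" if "i < n" for i
      using b that by (auto simp: carrier_Z4_power PiE_iff)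
    have eq: "(\<lambda>i\<in>{..<n}. ((\<lambda>i\<in>{..<n}. if i < k then b i else 0) i
          + (\<lambda>i\<in>{..<n}. if i = k then int (nat (b k)) mod 4 else 0) i) mod 4)
        = (\<lambda>i\<in>{..<n}. if i < Suc k then b i else 0)"
      using bnd Suc.prems by (intro restrict_ext) (auto simp: less_Suc_eq)
    have "k < n" "k \<le> n"
      using Suc.prems by auto
    show ?case
      using mult[OF Suc.IH[OF \<open>k \<le> n\<close>] multiple[OF \<open>k < n\<close>, of "nat (b k)"]]
      unfolding eq by blast
  qed
  have low: "(0, b) \<in> H" if b: "b \<in> carrier (Z4_power n)" for b
  proof -
    have "(\<lambda>i\<in>{..<n}. if i < n then b i else 0) = b"
      using b by (auto simp: carrier_Z4_power PiE_iff extensional_def)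
    then show ?thesis using partial[OF b order_refl] by simp
  qed
  have high: "(1, b) \<in> H" if b: "b \<in> carrier (Z4_power n)" for b
  proof -
    have "(\<lambda>i\<in>{..<n}. (b i - x i) mod 4) \<in> carrier (Z4_power n)"
      by (auto simp: carrier_Z4_power)
    from mult[OF x low[OF this]] have
      "(1, \<lambda>i\<in>{..<n}. (x i + (\<lambda>i\<in>{..<n}. (b i - x i) mod 4) i) mod 4) \<in> H"
      by blast
    moreover have "(\<lambda>i\<in>{..<n}. (x i + (\<lambda>i\<in>{..<n}. (b i - x i) mod 4) i) mod 4) = b"
      using b by (auto simp: carrier_Z4_power PiE_iff extensional_def mod_simps)
    ultimately show ?thesis by simp
  qed
  show ?thesis
    using subgroup.subset[OF H] low high by (auto simp: carrier_Z2_Z4_power)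
qed

lemma (in comm_group) diff_count_eq_shift:
  assumes A: "A \<subseteq> carrier G" and y: "y \<in> carrier G"
  shows "diff_count G A y = card {a \<in> A. a \<otimes> inv y \<in> A}"
proof -
  have eq: "y = a \<otimes> inv b \<longleftrightarrow> b = a \<otimes> inv y" if "a \<in> A" "b \<in> A" for a b
  proof -
    have ab: "a \<in> carrier G" "b \<in> carrier G"
      using that A by auto
    then show ?thesis
      using y by (metis inv_closed inv_solve_right m_comm)
  qed
  have "{(a1, a2). (a1, a2) \<in> A \<times> A \<and> y = a1 \<otimes> inv a2} = (\<lambda>a. (a, a \<otimes> inv y)) ` {a \<in> A. a \<otimes> inv y \<in> A}"
  proof (rule Set.set_eqI)
    fix p :: "'a \<times> 'a"
    obtain a b where p: "p = (a, b)" by (cases p)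
    show "p \<in> {(a1, a2). (a1, a2) \<in> A \<times> A \<and> y = a1 \<otimes> inv a2}
        \<longleftrightarrow> p \<in> (\<lambda>a. (a, a \<otimes> inv y)) ` {a \<in> A. a \<otimes> inv y \<in> A}"
      using eq[of a b]
      unfolding p image_iff mem_Sigma_iff Bex_def mem_Collect_eq prod.inject case_prod_conv
      by metis
  qed
  then show ?thesis
    unfolding diff_count_def by (simp add: card_image inj_on_def)
qed

text \<open>For a set \<open>A\<close> that contains the identity, a coset containing \<open>A\<close> is the subgroup itself, and a
  subgroup of whose cosets \<open>A\<close> is a union is contained in \<open>A\<close>. Periods therefore need to be excluded
  only among the elements of \<open>A\<close>.\<close>

lemma (in group) primitive_subsetI:
  assumes A: "A \<subseteq> carrier G" and one: "\<one> \<in> A"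
    and gen: "\<And>H. subgroup H G \<Longrightarrow> A \<subseteq> H \<Longrightarrow> H = carrier G"
    and aperiodic: "\<And>h. h \<in> A \<Longrightarrow> h \<noteq> \<one> \<Longrightarrow> \<exists>a\<in>A. h \<otimes> a \<notin> A"
  shows "primitive_subset G A"
  unfolding primitive_subset_def
proof (intro conjI notI; (elim exE conjE bexE)?)
  fix H C assume H: "subgroup H G" "H \<noteq> carrier G" and C: "C \<in> rcosets H" "A \<subseteq> C"
  obtain a where a: "a \<in> carrier G" "C = H #> a"
    using C by (auto simp: RCOSETS_def)
  have "C = H"
    using C(2) one a H(1) by (metis repr_independence subsetD coset_mult_one subgroup.subset)
  with gen[OF H(1)] C H show False by auto
next
  fix H \<C> assume H: "subgroup H G" "H \<noteq> {\<one>}" and C: "\<C> \<subseteq> rcosets H" "A = \<Union>\<C>"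
  have closed: "h \<otimes> a \<in> A" if h: "h \<in> H" and a: "a \<in> A" for h a
  proof -
    obtain D where D: "D \<in> \<C>" "a \<in> D" using a C by auto
    then obtain g where g: "g \<in> carrier G" "D = H #> g"
      using C by (auto simp: RCOSETS_def)
    then have "D = H #> a"
      using D H(1) by (metis repr_independence)
    then have "h \<otimes> a \<in> D" using h by (auto simp: r_coset_def)
    then show ?thesis using D C by auto
  qed
  obtain h where h: "h \<in> H" "h \<noteq> \<one>"
    using H subgroup.one_closed[OF H(1)] by auto
  then have "h \<in> A"
    using closed[OF h(1) one] subgroup.mem_carrier[OF H(1) h(1)] by simp
  with aperiodic[OF this h(2)] closed[OF h(1)] show False by auto
qed (fact A)

section \<open>The canonical isomorphism\<close>

lemma i_powi_mod: "\<i> powi (k mod 4) = \<i> powi k"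
proof -
  have "\<i> powi k = \<i> powi (4 * (k div 4) + k mod 4)" by simp
  also have "\<dots> = (\<i> powi 4) powi (k div 4) * \<i> powi (k mod 4)"
    by (subst power_int_add, simp, subst power_int_mult, rule refl)
  finally show ?thesis by simp
qed

lemma minus_one_powi_mod: "(-1 :: complex) powi (k mod 2) = (-1) powi k"
proof -
  have "(-1 :: complex) powi k = (-1) powi (2 * (k div 2) + k mod 2)" by simp
  also have "\<dots> = ((-1) powi 2) powi (k div 2) * (-1) powi (k mod 2)"
    by (subst power_int_add, simp, subst power_int_mult, rule refl)
  finally show ?thesis by simp
qed


lemma canonical_iso_apply:
  assumes "(a, b) \<in> carrier (Z2_Z4_power n)"
  shows "canonical_iso n (w, z) (a, b) = (-1) powi (w * a) * (\<Prod>i<n. \<i> powi (z i * b i))"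
proof -
  have "\<i> powi (\<Sum>i<k. z i * b i) = (\<Prod>i<k. \<i> powi (z i * b i))" for k
    by (induction k) (simp_all add: power_int_add)
  then show ?thesis using assms by (simp add: canonical_iso_def)
qed

lemma canonical_iso_commute:
  assumes "x \<in> carrier (Z2_Z4_power n)" "y \<in> carrier (Z2_Z4_power n)"
  shows "canonical_iso n x y = canonical_iso n y x"
  using assms by (cases x; cases y) (simp add: canonical_iso_apply mult.commute)

lemma canonical_iso_nonzero:
  assumes "y \<in> carrier (Z2_Z4_power n)"
  shows "canonical_iso n x y \<noteq> 0"
  using assms by (cases x; cases y) (simp add: canonical_iso_apply)

lemma canonical_iso_mult_right:
  assumes "y \<in> carrier (Z2_Z4_power n)" "y' \<in> carrier (Z2_Z4_power n)"
  shows "canonical_iso n x (y \<otimes>\<^bsub>Z2_Z4_power n\<^esub> y') = canonical_iso n x y * canonical_iso n x y'"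
proof -
  obtain w z a b a' b' where xy: "x = (w, z)" "y = (a, b)" "y' = (a', b')"
    by (cases x, cases y, cases y')
  have prod: "y \<otimes>\<^bsub>Z2_Z4_power n\<^esub> y' \<in> carrier (Z2_Z4_power n)"
    using assms by (intro monoid.m_closed group.is_monoid group_Z2_Z4_power)
  have sign: "(-1 :: complex) powi (w * ((a + a') mod 2)) = (-1) powi (w * a) * (-1) powi (w * a')"
  proof -
    have "(-1 :: complex) powi (w * ((a + a') mod 2)) = (-1) powi ((w * ((a + a') mod 2)) mod 2)"
      by (simp only: minus_one_powi_mod)
    also have "\<dots> = (-1) powi (w * a + w * a')"
      by (simp only: mod_mult_right_eq minus_one_powi_mod distrib_left)
    finally show ?thesis by (simp add: power_int_add)
  qed
  have phase: "\<i> powi (z i * ((b i + b' i) mod 4)) = \<i> powi (z i * b i) * \<i> powi (z i * b' i)" for i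
  proof -
    have "\<i> powi (z i * ((b i + b' i) mod 4)) = \<i> powi ((z i * ((b i + b' i) mod 4)) mod 4)"
      by (simp only: i_powi_mod)
    also have "\<dots> = \<i> powi (z i * b i + z i * b' i)"
      by (simp only: mod_mult_right_eq i_powi_mod distrib_left)
    finally show ?thesis by (simp add: power_int_add)
  qed
  have phases: "(\<Prod>i<n. \<i> powi (z i * (b \<otimes>\<^bsub>Z4_power n\<^esub> b') i))
      = (\<Prod>i<n. \<i> powi (z i * b i)) * (\<Prod>i<n. \<i> powi (z i * b' i))"
    unfolding prod.distrib[symmetric] by (rule prod.cong) (simp_all add: mult_Z4_power phase)
  show ?thesis
    using assms prod unfolding xy mult_Z2_Z4_power
    by (simp add: canonical_iso_apply sign phases)
qed

lemma carrier_dual_group_iff: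
  "f \<in> carrier (dual_group G) \<longleftrightarrow>
     f \<in> extensional (carrier G) \<and> (\<forall>x\<in>carrier G. f x \<noteq> 0) \<and>
     (\<forall>x\<in>carrier G. \<forall>y\<in>carrier G. f (x \<otimes>\<^bsub>G\<^esub> y) = f x * f y)"
  by (auto simp: dual_group_def nonzero_complex_group_def hom_def)

lemma canonical_iso_in_dual: "canonical_iso n x \<in> carrier (dual_group (Z2_Z4_power n))"
  unfolding carrier_dual_group_iff
proof (intro conjI ballI)
  show "canonical_iso n x \<in> extensional (carrier (Z2_Z4_power n))"
    by (cases x) (simp add: canonical_iso_def)
qed (rule canonical_iso_nonzero canonical_iso_mult_right; assumption)+

lemma canonical_iso_generator_sign:
  "canonical_iso n (w, z) (1, \<lambda>i\<in>{..<n}. 0) = (-1) powi w"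
  by (subst canonical_iso_apply) (auto simp: carrier_Z2_Z4_power zero_carrier)

lemma canonical_iso_generator_phase:
  assumes "i < n"
  shows "canonical_iso n (w, z) (0, unit_vec n i) = \<i> powi (z i)"
proof -
  have "(\<Prod>k<n. \<i> powi (z k * unit_vec n i k)) = (\<Prod>k<n. if k = i then \<i> powi (z i) else 1)"
    by (rule prod.cong) (auto simp: unit_vec_def)
  also have "\<dots> = \<i> powi (z i)" using assms by simp
  finally show ?thesis
    by (subst canonical_iso_apply) (auto simp: carrier_Z2_Z4_power unit_vec_carrier)
qed

lemma sign_inj:
  assumes "(-1 :: complex) powi w = (-1) powi w'" "w \<in> {0, 1}" "w' \<in> {0, 1}"
  shows "w = w'"
  using assms by auto

lemma residues_4: "{0..<4} = {0, 1, 2, 3 :: int}"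
  by auto

lemma phase_inj:
  assumes "\<i> powi z = \<i> powi z'" "z \<in> {0..<4}" "z' \<in> {0..<4}"
  shows "z = z'"
  using assms unfolding residues_4 by (auto simp: power3_eq_cube complex_eq_iff)

lemma fourth_root_of_unity:
  assumes "(c :: complex) ^ 4 = 1"
  shows "\<exists>z\<in>{0..<4}. c = \<i> powi z"
proof -
  have "(c - 1) * (c + 1) * (c - \<i>) * (c + \<i>) = c ^ 4 - 1"
    by (simp add: algebra_simps power4_eq_xxxx)
  then consider "c = 1" | "c = - 1" | "c = \<i>" | "c = - \<i>"
    using assms by (auto simp: eq_neg_iff_add_eq_0)
  then show ?thesis
    by cases (auto simp: residues_4 power3_eq_cube)
qed

text \<open>For surjectivity, a character \<open>f\<close> takes values \<open>(-1)\<^sup>w\<close> and \<open>\<i>\<close> to the power \<open>z i\<close> on the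
  generators \<open>(1, 0)\<close> and \<open>(0, e\<^sub>i)\<close>. The elements on which \<open>f\<close> agrees with the character of \<open>(w, z)\<close>
  form a subgroup that contains these generators.\<close>

lemma canonical_iso_is_iso:
  "canonical_iso n \<in> iso (Z2_Z4_power n) (dual_group (Z2_Z4_power n))"
proof -
  let ?G = "Z2_Z4_power n"
  interpret G: comm_group ?G by (rule comm_group_Z2_Z4_power)
  let ?e = "(1, \<lambda>i\<in>{..<n}. 0) :: int \<times> (nat \<Rightarrow> int)"
  have e: "?e \<in> carrier ?G"
    by (simp add: carrier_Z2_Z4_power zero_carrier del: restrict_apply)
  have u: "(0, unit_vec n i) \<in> carrier ?G" for i
    by (simp add: carrier_Z2_Z4_power unit_vec_carrier)
  have hom: "canonical_iso n \<in> hom ?G (dual_group ?G)"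
  proof (rule homI)
    fix x y assume xy: "x \<in> carrier ?G" "y \<in> carrier ?G"
    show "canonical_iso n (x \<otimes>\<^bsub>?G\<^esub> y) = canonical_iso n x \<otimes>\<^bsub>dual_group ?G\<^esub> canonical_iso n y"
    proof (rule extensionalityI[of _ "carrier ?G"])
      fix g assume g: "g \<in> carrier ?G"
      have "canonical_iso n (x \<otimes>\<^bsub>?G\<^esub> y) g = canonical_iso n g (x \<otimes>\<^bsub>?G\<^esub> y)"
        using xy g by (simp add: canonical_iso_commute)
      also have "\<dots> = canonical_iso n x g * canonical_iso n y g"
        using xy g by (simp add: canonical_iso_mult_right canonical_iso_commute[of g])
      finally show "canonical_iso n (x \<otimes>\<^bsub>?G\<^esub> y) g = (canonical_iso n x \<otimes>\<^bsub>dual_group ?G\<^esub> canonical_iso n y) g"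
        using g by (simp add: dual_group_def)
    qed (use canonical_iso_in_dual[of n] in \<open>auto simp: carrier_dual_group_iff\<close>,
        simp add: dual_group_def)
  qed (rule canonical_iso_in_dual)
  have inj: "inj_on (canonical_iso n) (carrier ?G)"
  proof (rule inj_onI, clarify)
    fix w z w' z' assume c: "(w, z) \<in> carrier ?G" "(w', z') \<in> carrier ?G"
      and eq: "canonical_iso n (w, z) = canonical_iso n (w', z')"
    have "w = w'"
      using fun_cong[OF eq, of ?e] c
      by (intro sign_inj) (auto simp: canonical_iso_generator_sign carrier_Z2_Z4_power)
    moreover have "z = z'"
    proof (rule extensionalityI[of _ "{..<n}"])
      fix i assume "i \<in> {..<n}"
      then have "i < n" by simp
      then have "\<i> powi z i = \<i> powi z' i"
        using fun_cong[OF eq, of "(0, unit_vec n i)"]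
        by (simp only: canonical_iso_generator_phase)
      then show "z i = z' i"
        by (rule phase_inj)
          (use c \<open>i < n\<close> in \<open>auto simp only: carrier_Z2_Z4_power carrier_Z4_power PiE_iff
            mem_Times_iff fst_conv snd_conv lessThan_iff\<close>)
    qed (use c in \<open>simp_all add: carrier_Z2_Z4_power carrier_Z4_power PiE_iff\<close>)
    ultimately show "w = w' \<and> z = z'" by simp
  qed
  have surj: "f \<in> canonical_iso n ` carrier ?G" if f: "f \<in> carrier (dual_group ?G)" for f
  proof -
    have mult: "f (x \<otimes>\<^bsub>?G\<^esub> y) = f x * f y" if "x \<in> carrier ?G" "y \<in> carrier ?G" for x y
      using f that by (simp add: carrier_dual_group_iff)
    have nz: "f x \<noteq> 0" if "x \<in> carrier ?G" for x
      using f that by (simp add: carrier_dual_group_iff)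
    have one: "f \<one>\<^bsub>?G\<^esub> = 1"
      using mult[of "\<one>\<^bsub>?G\<^esub>" "\<one>\<^bsub>?G\<^esub>"] nz[of "\<one>\<^bsub>?G\<^esub>"] by simp
    have "?e \<otimes>\<^bsub>?G\<^esub> ?e = \<one>\<^bsub>?G\<^esub>"
      by (auto simp: mult_Z2_Z4_power mult_Z4_power one_Z2_Z4_power one_Z4_power)
    then have "f ?e ^ 2 = 1"
      using mult[OF e e] one by (simp add: power2_eq_square)
    then have "f ?e = (-1) powi 0 \<or> f ?e = (-1) powi 1"
      by (simp only: power2_eq_1_iff power_int_0_right power_int_1_right)
    then obtain w :: int where w: "w \<in> {0, 1}" "f ?e = (-1) powi w"
      by blast
    have "\<exists>c\<in>{0..<4}. f (0, unit_vec n i) = \<i> powi c" for i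
    proof (rule fourth_root_of_unity)
      let ?u = "(0 :: int, unit_vec n i)"
      have "(?u \<otimes>\<^bsub>?G\<^esub> ?u) \<otimes>\<^bsub>?G\<^esub> (?u \<otimes>\<^bsub>?G\<^esub> ?u) = \<one>\<^bsub>?G\<^esub>"
        by (auto simp: mult_Z2_Z4_power mult_Z4_power one_Z2_Z4_power one_Z4_power unit_vec_def)
      moreover have "f ((?u \<otimes>\<^bsub>?G\<^esub> ?u) \<otimes>\<^bsub>?G\<^esub> (?u \<otimes>\<^bsub>?G\<^esub> ?u)) = (f ?u * f ?u) * (f ?u * f ?u)"
        using u by (simp only: mult G.m_closed)
      ultimately have "(f ?u * f ?u) * (f ?u * f ?u) = 1"
        using one by (simp only:)
      then show "f ?u ^ 4 = 1" by (simp add: power4_eq_xxxx mult.assoc)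
    qed
    then have "\<exists>c. \<forall>i. c i \<in> {0..<4} \<and> f (0, unit_vec n i) = \<i> powi c i"
      by (intro choice) blast
    then obtain c where c: "\<And>i. c i \<in> {0..<4}" "\<And>i. f (0, unit_vec n i) = \<i> powi c i"
      by blast
    define z where "z = restrict c {..<n}"
    let ?H = "{g \<in> carrier ?G. f g = canonical_iso n (w, z) g}"
    have "?H = carrier ?G"
    proof (rule Z2_Z4_power_generated)
      have one': "canonical_iso n (w, z) \<one>\<^bsub>?G\<^esub> = 1"
        using canonical_iso_mult_right[of "\<one>\<^bsub>?G\<^esub>" n "\<one>\<^bsub>?G\<^esub>" "(w, z)"]
          canonical_iso_nonzero[of "\<one>\<^bsub>?G\<^esub>" n "(w, z)"] by simp
      show "subgroup ?H ?G"
      proof (rule G.subgroupI)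
        fix g assume g: "g \<in> ?H"
        then have "f g * f (inv\<^bsub>?G\<^esub> g) = 1"
          using mult[of g "inv\<^bsub>?G\<^esub> g"] one by simp
        moreover have "f g * canonical_iso n (w, z) (inv\<^bsub>?G\<^esub> g) = 1"
          using g canonical_iso_mult_right[of g n "inv\<^bsub>?G\<^esub> g" "(w, z)"] one' by simp
        ultimately have "f (inv\<^bsub>?G\<^esub> g) = canonical_iso n (w, z) (inv\<^bsub>?G\<^esub> g)"
          by (rule inverse_unique[symmetric, THEN trans, OF _ inverse_unique])
        then show "inv\<^bsub>?G\<^esub> g \<in> ?H"
          using g by simp
      next
        fix g h assume "g \<in> ?H" "h \<in> ?H"
        then show "g \<otimes>\<^bsub>?G\<^esub> h \<in> ?H"
          by (simp add: mult canonical_iso_mult_right)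
      next
        have "\<one>\<^bsub>?G\<^esub> \<in> ?H"
          using one one' by simp
        then show "?H \<noteq> {}" by blast
      qed blast
      show "(0, unit_vec n i) \<in> ?H" if "i < n" for i
        unfolding mem_Collect_eq canonical_iso_generator_phase[OF that] c(2)
        using that u by (simp add: z_def)
      show "?e \<in> ?H"
        unfolding mem_Collect_eq canonical_iso_generator_sign w(2) using e by blast
    qed
    then have "f = canonical_iso n (w, z)"
      using f canonical_iso_in_dual[of n "(w, z)"]
      by (intro extensionalityI[of _ "carrier ?G"]) (auto simp: carrier_dual_group_iff)
    moreover have "(w, z) \<in> carrier ?G"
      unfolding carrier_Z2_Z4_power carrier_Z4_power z_def using w(1) c(1) by simp
    ultimately show ?thesis by blast
  qed
  show ?thesis
    unfolding iso_def bij_betw_def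
    using hom inj surj canonical_iso_in_dual by blast
qed


section \<open>Products of blocks\<close>

text \<open>The \<open>j\<close>-th block of a vector, an element of \<open>\<int>\<^sub>4\<^sup>2\<close>.\<close>

definition block :: "(nat \<Rightarrow> int) \<Rightarrow> nat \<Rightarrow> int \<times> int" where
  "block x j = (x (2 * j), x (2 * j + 1))"

text \<open>The residues representing \<open>\<int>\<^sub>4\<^sup>2\<close>.\<close>

definition Z4_square :: "(int \<times> int) set" where
  "Z4_square = {0..<4} \<times> {0..<4}"

lemma mem_block_prod:
  "x \<in> block_prod m N \<longleftrightarrow> x \<in> carrier (Z4_power (2 * m)) \<and> (\<forall>j<m. block x j \<in> N j)"
  by (simp add: block_prod_def block_def)

lemma block_in_Z4_square:
  assumes "x \<in> carrier (Z4_power (2 * m))" "j < m"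
  shows "block x j \<in> Z4_square"
  using assms by (auto simp: block_def Z4_square_def carrier_Z4_power PiE_iff)

lemma finite_block_prod: "finite (block_prod m N)"
  by (rule finite_subset[OF _ finite_Z4_power]) (auto simp: block_prod_def)

lemma block_prod_eqI:
  assumes "x \<in> carrier (Z4_power (2 * m))" "y \<in> carrier (Z4_power (2 * m))"
    and "\<And>j. j < m \<Longrightarrow> block x j = block y j"
  shows "x = y"
proof (rule extensionalityI[of _ "{..<2 * m}"])
  fix i assume "i \<in> {..<2 * m}"
  then have "i div 2 < m" by auto
  from assms(3)[OF this] show "x i = y i"
    unfolding block_def by (cases "even i") (auto simp: elim: evenE oddE)
qed (use assms in \<open>simp_all add: carrier_Z4_power PiE_iff\<close>)

lemma bij_betw_blocks:
  assumes "\<And>j. j < m \<Longrightarrow> N j \<subseteq> Z4_square"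
  shows "bij_betw (\<lambda>x. restrict (block x) {..<m}) (block_prod m N) (PiE {..<m} N)"
proof (rule bij_betw_imageI)
  show "inj_on (\<lambda>x. restrict (block x) {..<m}) (block_prod m N)"
  proof (rule inj_onI)
    fix x y assume xy: "x \<in> block_prod m N" "y \<in> block_prod m N"
      and eq: "restrict (block x) {..<m} = restrict (block y) {..<m}"
    show "x = y"
    proof (rule block_prod_eqI)
      fix j assume "j < m"
      then show "block x j = block y j"
        using fun_cong[OF eq, of j] by simp
    qed (use xy in \<open>simp_all add: mem_block_prod\<close>)
  qed
  show "(\<lambda>x. restrict (block x) {..<m}) ` block_prod m N = PiE {..<m} N"
  proof (intro equalityI subsetI)
    fix g assume "g \<in> (\<lambda>x. restrict (block x) {..<m}) ` block_prod m N"
    then obtain x where "x \<in> block_prod m N" "g = restrict (block x) {..<m}"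
      by blast
    then show "g \<in> PiE {..<m} N"
      unfolding mem_block_prod by (simp only: restrict_PiE_iff) simp
  next
    fix g assume g: "g \<in> PiE {..<m} N"
    define x where "x = (\<lambda>i\<in>{..<2 * m}. (if even i then fst else snd) (g (i div 2)))"
    have block: "block x j = g j" if "j < m" for j
      using that by (simp add: block_def x_def)
    have "x i \<in> {0..<4}" if "i < 2 * m" for i
    proof -
      have "g (i div 2) \<in> Z4_square"
        using PiE_mem[OF g, of "i div 2"] assms[of "i div 2"] less_mult_imp_div_less[of i m 2] that
        by (auto simp: mult.commute)
      then show ?thesis
        using that by (auto simp: x_def Z4_square_def mem_Times_iff)
    qed
    then have "x \<in> carrier (Z4_power (2 * m))"
      unfolding carrier_Z4_power PiE_iff by (auto simp: x_def)
    then have "x \<in> block_prod m N"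
      using g block by (auto simp: mem_block_prod PiE_iff)
    moreover have "g = restrict (block x) {..<m}"
      by (rule extensionalityI[of _ "{..<m}"]) (use g block in \<open>auto simp: PiE_iff\<close>)
    ultimately show "g \<in> (\<lambda>x. restrict (block x) {..<m}) ` block_prod m N"
      by blast
  qed
qed

text \<open>Every character sum and every count below is an instance of this factorization.\<close>

lemma sum_block_prod:
  fixes f :: "nat \<Rightarrow> int \<times> int \<Rightarrow> 'a :: comm_semiring_1"
  assumes "\<And>j. j < m \<Longrightarrow> N j \<subseteq> Z4_square"
  shows "(\<Sum>x\<in>block_prod m N. \<Prod>j<m. f j (block x j)) = (\<Prod>j<m. \<Sum>u\<in>N j. f j u)"
proof -
  have fin: "finite (N j)" if "j < m" for j
    by (rule finite_subset[OF assms[OF that]]) (simp add: Z4_square_def)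
  have "(\<Sum>x\<in>block_prod m N. \<Prod>j<m. f j (block x j))
      = (\<Sum>x\<in>block_prod m N. \<Prod>j<m. f j (restrict (block x) {..<m} j))"
    by (intro sum.cong prod.cong) auto
  also have "\<dots> = (\<Sum>g\<in>PiE {..<m} N. \<Prod>j<m. f j (g j))"
    by (rule sum.reindex_bij_betw[OF bij_betw_blocks[OF assms]])
  also have "\<dots> = (\<Prod>j<m. \<Sum>u\<in>N j. f j u)"
    using fin by (intro prod_sum_PiE[symmetric]) auto
  finally show ?thesis .
qed

lemma card_block_prod:
  assumes "\<And>j. j < m \<Longrightarrow> N j \<subseteq> Z4_square"
  shows "card (block_prod m N) = (\<Prod>j<m. card (N j))"
  using sum_block_prod[OF assms, where f = "\<lambda>_ _. 1 :: nat"] by simp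

text \<open>The number of \<open>v \<in> A\<close> with \<open>v - u \<in> B\<close> in \<open>\<int>\<^sub>4\<^sup>2\<close>, that is, the number of representations of \<open>u\<close>
  as a difference of an element of \<open>A\<close> and an element of \<open>B\<close>.\<close>

definition shift_count :: "(int \<times> int) set \<Rightarrow> (int \<times> int) set \<Rightarrow> int \<times> int \<Rightarrow> nat" where
  "shift_count A B u = card {v \<in> A. ((fst v - fst u) mod 4, (snd v - snd u) mod 4) \<in> B}"

lemma block_shift:
  assumes z: "z \<in> carrier (Z4_power (2 * m))" and "j < m"
  shows "block (x \<otimes>\<^bsub>Z4_power (2 * m)\<^esub> inv\<^bsub>Z4_power (2 * m)\<^esub> z) j
    = ((fst (block x j) - fst (block z j)) mod 4, (snd (block x j) - snd (block z j)) mod 4)"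
  using \<open>j < m\<close> by (simp add: block_def mult_Z4_power inv_Z4_power[OF z] mod_simps)

lemma card_shift_block_prod:
  assumes z: "z \<in> carrier (Z4_power (2 * m))" and A: "A \<subseteq> Z4_square"
  shows "card {x \<in> block_prod m (\<lambda>_. A).
      x \<otimes>\<^bsub>Z4_power (2 * m)\<^esub> inv\<^bsub>Z4_power (2 * m)\<^esub> z \<in> block_prod m (\<lambda>_. B)}
    = (\<Prod>j<m. shift_count A B (block z j))"
proof -
  let ?N = "\<lambda>j. {v \<in> A. ((fst v - fst (block z j)) mod 4, (snd v - snd (block z j)) mod 4) \<in> B}"
  have "x \<otimes>\<^bsub>Z4_power (2 * m)\<^esub> inv\<^bsub>Z4_power (2 * m)\<^esub> z \<in> carrier (Z4_power (2 * m))"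
    if "x \<in> carrier (Z4_power (2 * m))" for x
    using that z by (intro monoid.m_closed group.inv_closed group.is_monoid group_Z4_power)
  then have "{x \<in> block_prod m (\<lambda>_. A).
      x \<otimes>\<^bsub>Z4_power (2 * m)\<^esub> inv\<^bsub>Z4_power (2 * m)\<^esub> z \<in> block_prod m (\<lambda>_. B)} = block_prod m ?N"
    using block_shift[OF z] by (auto simp: mem_block_prod)
  then show ?thesis
    using A by (simp add: card_block_prod subset_iff shift_count_def)
qed

section \<open>The four-element building block\<close>

text \<open>The set \<open>-L\<close> in \<open>\<int>\<^sub>4\<^sup>2\<close>.\<close>

definition L_neg :: "(int \<times> int) set" where
  "L_neg = {(0, 0), (0, 3), (3, 0), (1, 1)}"

text \<open>The character of \<open>\<int>\<^sub>4\<^sup>2\<close> belonging to \<open>u\<close>, evaluated at \<open>v\<close>.\<close>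

definition phase :: "int \<times> int \<Rightarrow> int \<times> int \<Rightarrow> complex" where
  "phase u v = \<i> powi (fst u * fst v) * \<i> powi (snd u * snd v)"

lemma L_subset: "L \<subseteq> Z4_square" "L_neg \<subseteq> Z4_square"
  by (auto simp: L_def L_neg_def Z4_square_def)

lemma finite_L: "finite L" "finite L_neg"
  by (simp_all add: L_def L_neg_def)

lemma shift_count_eq_sum:
  "finite A \<Longrightarrow> shift_count A B u
    = (\<Sum>v\<in>A. if ((fst v - fst u) mod 4, (snd v - snd u) mod 4) \<in> B then 1 else 0)"
  by (simp add: shift_count_def sum.If_cases Int_def)

lemma shift_count_L:
  "shift_count L B (a, b)
    = of_bool ((- a mod 4, - b mod 4) \<in> B) + of_bool ((- a mod 4, (1 - b) mod 4) \<in> B)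
    + of_bool (((1 - a) mod 4, - b mod 4) \<in> B) + of_bool (((3 - a) mod 4, (3 - b) mod 4) \<in> B)"
  unfolding shift_count_eq_sum[OF finite_L(1)] by (simp add: L_def)

lemma Z4_square_cases:
  assumes "u \<in> Z4_square"
  obtains "u = (0, 0)" | "u = (0, 1)" | "u = (0, 2)" | "u = (0, 3)"
    | "u = (1, 0)" | "u = (1, 1)" | "u = (1, 2)" | "u = (1, 3)"
    | "u = (2, 0)" | "u = (2, 1)" | "u = (2, 2)" | "u = (2, 3)"
    | "u = (3, 0)" | "u = (3, 1)" | "u = (3, 2)" | "u = (3, 3)"
  using assms unfolding Z4_square_def residues_4 by blast

text \<open>The sets \<open>L - L\<close> and, less obviously, \<open>L + L\<close> are symmetric with multiplicities.\<close>

lemma shift_count_symmetric: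
  assumes "u \<in> Z4_square"
  shows "shift_count L_neg L_neg u = shift_count L L u"
    and "shift_count L_neg L u = shift_count L L_neg u"
  using assms
  by (cases rule: Z4_square_cases; simp add: shift_count_eq_sum finite_L; simp add: L_def L_neg_def)+

lemma i_power_values: "\<i> ^ 3 = - \<i>" "\<i> ^ 6 = -1" "\<i> ^ 9 = \<i>"
proof -
  have "\<i> ^ (2 * k) = (-1) ^ k" for k
    by (simp add: power_mult)
  from this[of 3] this[of 4] show "\<i> ^ 6 = -1" "\<i> ^ 9 = \<i>"
    by (simp_all add: power_Suc[of \<i> 8, simplified])
qed (simp add: power3_eq_cube)

text \<open>The next two identities are the case \<open>m = 1\<close> of formal duality, for \<open>w = 0\<close> and \<open>w = 1\<close>.\<close>

lemma L_phase_sum: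
  assumes "u \<in> Z4_square"
  shows "(cmod (\<Sum>v\<in>L. phase u v))\<^sup>2 = 4 * real (shift_count L L u)"
  using assms
  by (cases rule: Z4_square_cases; simp add: shift_count_eq_sum finite_L;
      simp add: L_def phase_def i_power_values cmod_power2)

lemma L_twisted_phase_sum:
  assumes "u \<in> Z4_square"
  shows "(cmod (\<Sum>v\<in>L. (if v = (3, 3) then -1 else 1) * phase u v))\<^sup>2
    = 4 * real (shift_count L L_neg u)"
  using assms
  by (cases rule: Z4_square_cases; simp add: shift_count_eq_sum finite_L;
      simp add: L_def L_neg_def phase_def i_power_values cmod_power2)

lemma shift_count_zero_iff:
  assumes "u \<in> Z4_square"
  shows "shift_count L L u = 0 \<longleftrightarrow> u \<in> {(0, 2), (2, 0), (2, 2)}"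
    and "shift_count L L_neg u = 0 \<longleftrightarrow> u \<in> {(1, 2), (1, 3), (2, 1), (2, 3), (3, 1), (3, 2)}"
  using assms
  by (cases rule: Z4_square_cases; simp only: shift_count_L; simp add: L_def L_neg_def)+

lemma card_shift_count_support:
  "card {u \<in> Z4_square. shift_count L L u \<noteq> 0} = 13"
  "card {u \<in> Z4_square. shift_count L L_neg u \<noteq> 0} = 10"
proof -
  have support: "{u \<in> A. f u \<noteq> 0} = A - Z" if "\<And>u. u \<in> A \<Longrightarrow> f u = 0 \<longleftrightarrow> u \<in> Z"
    for A Z :: "(int \<times> int) set" and f :: "int \<times> int \<Rightarrow> nat"
    using that by (simp add: set_diff_eq cong: conj_cong)
  have card: "card (Z4_square - Z) = 16 - card Z" if "Z \<subseteq> Z4_square" "finite Z" for Z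
    using that by (simp add: card_Diff_subset) (simp add: Z4_square_def)
  have "{u \<in> Z4_square. shift_count L L u \<noteq> 0} = Z4_square - {(0, 2), (2, 0), (2, 2)}"
    by (rule support) (rule shift_count_zero_iff)
  then show "card {u \<in> Z4_square. shift_count L L u \<noteq> 0} = 13"
    by (simp only:) (subst card; simp add: Z4_square_def)
  have "{u \<in> Z4_square. shift_count L L_neg u \<noteq> 0}
      = Z4_square - {(1, 2), (1, 3), (2, 1), (2, 3), (3, 1), (3, 2)}"
    by (rule support) (rule shift_count_zero_iff)
  then show "card {u \<in> Z4_square. shift_count L L_neg u \<noteq> 0} = 10"
    by (simp only:) (subst card; simp add: Z4_square_def)
qed

lemma double_L:
  assumes "v \<in> L \<union> L_neg" "((fst v + fst v) mod 4, (snd v + snd v) mod 4) \<in> L"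
  shows "v = (0, 0)"
  using assms by (auto simp: L_def L_neg_def)

lemma negate_L_iff:
  assumes "v \<in> Z4_square"
  shows "((- fst v) mod 4, (- snd v) mod 4) \<in> L \<longleftrightarrow> v \<in> L_neg"
  using assms by (cases rule: Z4_square_cases; simp add: L_def L_neg_def)

section \<open>The sets of the construction\<close>

text \<open>The number of blocks of \<open>x\<close> that lie in \<open>L2 = {(3, 3)}\<close>.\<close>

definition twist :: "nat \<Rightarrow> (nat \<Rightarrow> int) \<Rightarrow> nat" where
  "twist m x = card {j. j < m \<and> block x j = (3, 3)}"

lemma mem_E_set:
  assumes "i \<le> m"
  shows "x \<in> E_set m i \<longleftrightarrow> x \<in> S_set m \<and> twist m x = m - i"
proof
  assume "x \<in> E_set m i"
  then obtain N where N: "\<forall>j<m. N j \<in> {L1, L2}" "card {j. j < m \<and> N j = L2} = m - i"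
    and x: "x \<in> block_prod m N"
    unfolding E_set_def by blast
  have xN: "block x j \<in> N j" if "j < m" for j
    using x that by (simp add: mem_block_prod)
  have "block x j = (3, 3) \<longleftrightarrow> N j = L2" "block x j \<in> L" if "j < m" for j
    using xN[OF that] N(1) that by (auto simp: L1_def L2_def L_def)
  then have "{j. j < m \<and> block x j = (3, 3)} = {j. j < m \<and> N j = L2}" "x \<in> S_set m"
    using x by (auto simp: S_set_def mem_block_prod)
  with N(2) show "x \<in> S_set m \<and> twist m x = m - i"
    by (simp add: twist_def)
next
  assume x: "x \<in> S_set m \<and> twist m x = m - i"
  \<comment> \<open>\<open>L1\<close> and \<open>L2\<close> partition \<open>L\<close>, so \<open>x\<close> itself determines the factors.\<close>
  define N where "N = (\<lambda>j. if block x j = (3, 3) then L2 else L1)"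
  have "L1 \<noteq> L2" by (auto simp: L1_def L2_def)
  then have two: "{j. j < m \<and> N j = L2} = {j. j < m \<and> block x j = (3, 3)}"
    and one: "{j. j < m \<and> N j = L1} = {..<m} - {j. j < m \<and> block x j = (3, 3)}"
    by (auto simp: N_def)
  have "card {j. j < m \<and> N j = L1} = m - twist m x"
    unfolding one twist_def by (subst card_Diff_subset) auto
  moreover have "card {j. j < m \<and> N j = L2} = m - i"
    unfolding two using x by (simp add: twist_def)
  moreover have "x \<in> block_prod m N"
    using x by (auto simp: S_set_def mem_block_prod N_def L_def L1_def L2_def)
  moreover have "\<forall>j<m. N j \<in> {L1, L2}"
    by (simp add: N_def)
  ultimately show "x \<in> E_set m i"
    using x assms unfolding E_set_def by auto
qed

lemma twist_le: "twist m x \<le> m"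
proof -
  have "twist m x \<le> card {..<m}"
    unfolding twist_def by (rule card_mono) auto
  then show ?thesis by simp
qed

lemma odd_minus_odd_iff_even: "(\<exists>i\<le>k. t = 2 * k + 1 - (2 * i + 1)) \<longleftrightarrow> even t" if "t \<le> 2 * k + 1" for k t :: nat
proof
  assume "even t"
  then have "k - t div 2 \<le> k" "t = 2 * k + 1 - (2 * (k - t div 2) + 1)"
    using that by (auto elim!: evenE)
  then show "\<exists>i\<le>k. t = 2 * k + 1 - (2 * i + 1)" by blast
qed auto

lemma odd_minus_even_iff_odd: "(\<exists>i\<le>k. t = 2 * k + 1 - 2 * i) \<longleftrightarrow> odd t" if "t \<le> 2 * k + 1" for k t :: nat
proof
  assume "odd t"
  then have "k - t div 2 \<le> k" "t = 2 * k + 1 - 2 * (k - t div 2)"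
    using that by (auto elim!: oddE)
  then show "\<exists>i\<le>k. t = 2 * k + 1 - 2 * i" by blast
qed (use that in auto)

lemma even_minus_even_iff_even: "(\<exists>i\<le>k. t = 2 * k - 2 * i) \<longleftrightarrow> even t" if "t \<le> 2 * k" for k t :: nat
proof
  assume "even t"
  then have "k - t div 2 \<le> k" "t = 2 * k - 2 * (k - t div 2)"
    using that by (auto elim!: evenE)
  then show "\<exists>i\<le>k. t = 2 * k - 2 * i" by blast
qed (use that in auto)

lemma even_minus_odd_iff_odd: "(\<exists>i<k. t = 2 * k - (2 * i + 1)) \<longleftrightarrow> odd t" if "t \<le> 2 * k" for k t :: nat
proof
  assume "odd t"
  then have "k - 1 - t div 2 < k" "t = 2 * k - (2 * (k - 1 - t div 2) + 1)"
    using that by (auto elim!: oddE)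
  then show "\<exists>i<k. t = 2 * k - (2 * i + 1)" by blast
qed (use that in auto)

text \<open>For either parity of \<open>m\<close>, the set \<open>S0\<close> is the union of all \<open>E_set m i\<close> with \<open>i \<le> m\<close> and
  \<open>m - i\<close> even, and \<open>m - i\<close> is the twist of the elements of \<open>E_set m i\<close>.\<close>

lemma S0_eq: "S0 m = {x \<in> S_set m. even (twist m x)}"
proof (rule Set.set_eqI)
  fix x
  have "x \<in> S0 m \<longleftrightarrow> x \<in> S_set m \<and> even (twist m x)"
  proof (cases "odd m")
    case True
    have "x \<in> S0 m \<longleftrightarrow> (\<exists>i\<in>{0..(m - 1) div 2}. x \<in> E_set m (2 * i + 1))"
      using True by (simp add: S0_def)
    also have "\<dots> \<longleftrightarrow> (\<exists>i\<in>{0..(m - 1) div 2}. x \<in> S_set m \<and> twist m x = m - (2 * i + 1))"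
    proof (rule bex_cong[OF refl], rule mem_E_set)
      fix i assume "i \<in> {0..(m - 1) div 2}"
      then show "2 * i + 1 \<le> m" using True by (auto elim: oddE)
    qed
    also have "(\<exists>i\<in>{0..(m - 1) div 2}. x \<in> S_set m \<and> twist m x = m - (2 * i + 1))
        \<longleftrightarrow> x \<in> S_set m \<and> even (twist m x)"
    proof -
      obtain k where k: "m = 2 * k + 1"
        using True by (elim oddE)
      then have "(m - 1) div 2 = k" "twist m x \<le> 2 * k + 1"
        using twist_le[of m x] by simp_all
      then show ?thesis
        using odd_minus_odd_iff_even[of "twist m x" k] by (auto simp: k Bex_def)
    qed
    finally show ?thesis .
  next
    case False
    have "x \<in> S0 m \<longleftrightarrow> (\<exists>i\<in>{0..m div 2}. x \<in> E_set m (2 * i))"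
      using False by (simp add: S0_def)
    also have "\<dots> \<longleftrightarrow> (\<exists>i\<in>{0..m div 2}. x \<in> S_set m \<and> twist m x = m - 2 * i)"
      by (rule bex_cong[OF refl], rule mem_E_set) auto
    also have "\<dots> \<longleftrightarrow> x \<in> S_set m \<and> even (twist m x)"
    proof -
      obtain k where k: "m = 2 * k"
        using False by (auto elim: evenE)
      then have "m div 2 = k" "twist m x \<le> 2 * k"
        using twist_le[of m x] by simp_all
      then show ?thesis
        using even_minus_even_iff_even[of "twist m x" k] by (auto simp: k Bex_def)
    qed
    finally show ?thesis .
  qed
  then show "x \<in> S0 m \<longleftrightarrow> x \<in> {x \<in> S_set m. even (twist m x)}" by simp
qed

lemma S1_eq: "S1 m = {x \<in> S_set m. odd (twist m x)}"
proof (rule Set.set_eqI)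
  fix x
  have "x \<in> S1 m \<longleftrightarrow> x \<in> S_set m \<and> odd (twist m x)"
  proof (cases "odd m")
    case True
    have "x \<in> S1 m \<longleftrightarrow> (\<exists>i\<in>{0..(m - 1) div 2}. x \<in> E_set m (2 * i))"
      using True by (simp add: S1_def)
    also have "\<dots> \<longleftrightarrow> (\<exists>i\<in>{0..(m - 1) div 2}. x \<in> S_set m \<and> twist m x = m - 2 * i)"
      by (rule bex_cong[OF refl], rule mem_E_set) auto
    also have "\<dots> \<longleftrightarrow> x \<in> S_set m \<and> odd (twist m x)"
    proof -
      obtain k where k: "m = 2 * k + 1"
        using True by (elim oddE)
      then have "(m - 1) div 2 = k" "twist m x \<le> 2 * k + 1"
        using twist_le[of m x] by simp_all
      then show ?thesis
        using odd_minus_even_iff_odd[of "twist m x" k] by (auto simp: k Bex_def)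
    qed
    finally show ?thesis .
  next
    case False
    have "x \<in> S1 m \<longleftrightarrow> (\<exists>i\<in>{0..<m div 2}. x \<in> E_set m (2 * i + 1))"
      using False by (simp add: S1_def)
    also have "\<dots> \<longleftrightarrow> (\<exists>i\<in>{0..<m div 2}. x \<in> S_set m \<and> twist m x = m - (2 * i + 1))"
      by (rule bex_cong[OF refl], rule mem_E_set) auto
    also have "\<dots> \<longleftrightarrow> x \<in> S_set m \<and> odd (twist m x)"
    proof -
      obtain k where k: "m = 2 * k"
        using False by (auto elim: evenE)
      then have "m div 2 = k" "twist m x \<le> 2 * k"
        using twist_le[of m x] by simp_all
      then show ?thesis
        using even_minus_odd_iff_odd[of "twist m x" k] by (auto simp: k Bex_def)
    qed
    finally show ?thesis .
  qed
  then show "x \<in> S1 m \<longleftrightarrow> x \<in> {x \<in> S_set m. odd (twist m x)}" by simp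
qed

text \<open>Appending the parity of the twist turns the two-part definition of \<open>S'\<close> into the image of
  the block product \<open>S_set m\<close> under an injective map.\<close>

lemma S'_eq: "S' m = (\<lambda>x. (int (twist m x mod 2), x)) ` S_set m"
  unfolding S'_def S0_eq S1_eq
  by (auto simp: even_iff_mod_2_eq_zero odd_iff_mod_2_eq_one image_iff)

lemma block_inv:
  assumes "x \<in> carrier (Z4_power (2 * m))" "j < m"
  shows "block (inv\<^bsub>Z4_power (2 * m)\<^esub> x) j = ((- fst (block x j)) mod 4, (- snd (block x j)) mod 4)"
  using assms(2) by (simp add: block_def inv_Z4_power[OF assms(1)])

lemma set_inv_T_set: "set_inv\<^bsub>Z4_power (2 * m)\<^esub> (T_set m) = block_prod m (\<lambda>_. L_neg)"
proof -
  interpret Z4: group "Z4_power (2 * m)" by (rule group_Z4_power)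
  have iff: "inv\<^bsub>Z4_power (2 * m)\<^esub> x \<in> T_set m \<longleftrightarrow> x \<in> block_prod m (\<lambda>_. L_neg)"
    if x: "x \<in> carrier (Z4_power (2 * m))" for x
    using x by (simp add: T_set_def mem_block_prod block_inv negate_L_iff block_in_Z4_square)
  have carrier: "x \<in> carrier (Z4_power (2 * m))" if "x \<in> block_prod m N" for x N
    using that by (simp add: mem_block_prod)
  show ?thesis
  proof (intro equalityI subsetI)
    fix x assume "x \<in> set_inv\<^bsub>Z4_power (2 * m)\<^esub> (T_set m)"
    then obtain y where y: "y \<in> T_set m" "x = inv\<^bsub>Z4_power (2 * m)\<^esub> y"
      by (auto simp: SET_INV_def)
    then have "y \<in> carrier (Z4_power (2 * m))"
      by (auto simp: T_set_def intro: carrier)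
    with y show "x \<in> block_prod m (\<lambda>_. L_neg)"
      using iff[of x] by simp
  next
    fix x assume x: "x \<in> block_prod m (\<lambda>_. L_neg)"
    then have "inv\<^bsub>Z4_power (2 * m)\<^esub> x \<in> T_set m" "x = inv\<^bsub>Z4_power (2 * m)\<^esub> (inv\<^bsub>Z4_power (2 * m)\<^esub> x)"
      using iff[of x] carrier[OF x] by simp_all
    then show "x \<in> set_inv\<^bsub>Z4_power (2 * m)\<^esub> (T_set m)"
      unfolding SET_INV_def by blast
  qed
qed

lemma T'_eq: "T' m = {0} \<times> block_prod m (\<lambda>_. L) \<union> {1} \<times> block_prod m (\<lambda>_. L_neg)"
  unfolding T'_def set_inv_T_set unfolding T_set_def by auto

lemma block_prod_subset: "block_prod m N \<subseteq> carrier (Z4_power (2 * m))"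
  by (auto simp: mem_block_prod)

lemma T'_subset: "T' m \<subseteq> carrier (Z2_Z4_power (2 * m))"
  unfolding T'_eq carrier_Z2_Z4_power using block_prod_subset by auto

lemma S'_subset: "S' m \<subseteq> carrier (Z2_Z4_power (2 * m))"
  unfolding S'_eq carrier_Z2_Z4_power S_set_def using block_prod_subset by auto

lemma card_L: "card L = 4" "card L_neg = 4"
  by (simp_all add: L_def L_neg_def)

lemma card_T': "card (T' m) = 2 * 4 ^ m"
  unfolding T'_eq
  by (subst card_Un_disjoint)
    (auto simp: finite_block_prod card_cartesian_product card_block_prod L_subset card_L)

lemma card_S': "card (S' m) = 4 ^ m"
  unfolding S'_eq
  by (subst card_image) (auto simp: inj_on_def S_set_def card_block_prod L_subset card_L)

lemma diff_count_T':
  assumes w: "w \<in> {0, 1}" and z: "z \<in> carrier (Z4_power (2 * m))"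
  shows "diff_count (Z2_Z4_power (2 * m)) (T' m) (w, z)
    = 2 * (\<Prod>j<m. shift_count L (if w = 0 then L else L_neg) (block z j))"
proof -
  let ?G = "Z2_Z4_power (2 * m)" and ?Z = "Z4_power (2 * m)"
  let ?P = "\<lambda>A. block_prod m (\<lambda>_. A)"
  let ?shift = "\<lambda>A B. {x \<in> ?P A. x \<otimes>\<^bsub>?Z\<^esub> inv\<^bsub>?Z\<^esub> z \<in> ?P B}"
  \<comment> \<open>Shifting by \<open>w = 1\<close> swaps the two layers of \<open>T'\<close>; \<open>B\<close> and \<open>B'\<close> are the blocks of the layers
    into which the lower and the upper layer are shifted.\<close>
  define B where "B = (if w = 0 then L else L_neg)"
  define B' where "B' = (if w = 0 then L_neg else L)"
  have wz: "(w, z) \<in> carrier ?G"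
    using w z by (simp add: carrier_Z2_Z4_power)
  have "diff_count ?G (T' m) (w, z) = card {a \<in> T' m. a \<otimes>\<^bsub>?G\<^esub> inv\<^bsub>?G\<^esub> (w, z) \<in> T' m}"
    by (rule comm_group.diff_count_eq_shift[OF comm_group_Z2_Z4_power T'_subset wz])
  also have "{a \<in> T' m. a \<otimes>\<^bsub>?G\<^esub> inv\<^bsub>?G\<^esub> (w, z) \<in> T' m}
      = {0} \<times> ?shift L B \<union> {1} \<times> ?shift L_neg B'"
    unfolding inv_Z2_Z4_power[OF w z]
    using w by (auto simp: T'_eq mult_Z2_Z4_power B_def B'_def)
  also have "card \<dots> = card (?shift L B) + card (?shift L_neg B')"
    by (subst card_Un_disjoint) (auto simp: finite_block_prod card_cartesian_product)
  also have "\<dots> = (\<Prod>j<m. shift_count L B (block z j)) + (\<Prod>j<m. shift_count L_neg B' (block z j))"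
    by (simp only: card_shift_block_prod[OF z] L_subset)
  also have "(\<Prod>j<m. shift_count L_neg B' (block z j)) = (\<Prod>j<m. shift_count L B (block z j))"
    by (rule prod.cong) (auto simp: B_def B'_def shift_count_symmetric block_in_Z4_square[OF z])
  finally show ?thesis by (simp add: B_def)
qed

lemma prod_pairs: "(\<Prod>i<2 * m. f i) = (\<Prod>j<m. f (2 * j) * f (2 * j + 1 :: nat))"
  for f :: "nat \<Rightarrow> 'a :: comm_monoid_mult"
  by (induction m) (simp_all add: mult.assoc)

lemma char_sum_S':
  assumes w: "w \<in> {0, 1}"
  shows "char_sum (canonical_iso (2 * m) (w, z)) (S' m)
    = (\<Prod>j<m. \<Sum>v\<in>L. (if w = 1 \<and> v = (3, 3) then -1 else 1) * phase (block z j) v)"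
proof -
  let ?c = "\<lambda>v :: int \<times> int. if w = 1 \<and> v = (3, 3) then -1 else 1 :: complex"
  have sign: "(-1) powi (w * int (twist m x mod 2)) = (\<Prod>j<m. ?c (block x j))" for x
  proof (cases "w = 0")
    case False
    then have "w = 1" using w by simp
    have "(\<Prod>j<m. ?c (block x j)) = (-1) ^ twist m x"
      using \<open>w = 1\<close> by (simp add: prod.If_cases twist_def lessThan_def Int_def)
    also have "\<dots> = (-1) powi int (twist m x mod 2)"
      by (simp only: zmod_int of_nat_numeral minus_one_powi_mod power_int_of_nat)
    finally show ?thesis using \<open>w = 1\<close> by simp
  qed simp
  have "char_sum (canonical_iso (2 * m) (w, z)) (S' m)
      = (\<Sum>x\<in>S_set m. canonical_iso (2 * m) (w, z) (int (twist m x mod 2), x))"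
    unfolding char_sum_def S'_eq by (subst sum.reindex) (auto simp: inj_on_def)
  also have "\<dots> = (\<Sum>x\<in>S_set m. \<Prod>j<m. ?c (block x j) * phase (block z j) (block x j))"
  proof (rule sum.cong)
    fix x assume "x \<in> S_set m"
    then have "(int (twist m x mod 2), x) \<in> carrier (Z2_Z4_power (2 * m))"
      using S'_subset[of m] unfolding S'_eq by blast
    then have "canonical_iso (2 * m) (w, z) (int (twist m x mod 2), x)
      = (\<Prod>j<m. ?c (block x j)) * (\<Prod>i<2 * m. \<i> powi (z i * x i))"
      by (simp only: canonical_iso_apply sign)
    also have "(\<Prod>i<2 * m. \<i> powi (z i * x i)) = (\<Prod>j<m. phase (block z j) (block x j))"
      by (simp add: prod_pairs phase_def block_def)
    finally show "canonical_iso (2 * m) (w, z) (int (twist m x mod 2), x)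
      = (\<Prod>j<m. ?c (block x j) * phase (block z j) (block x j))"
      by (simp only: prod.distrib)
  qed simp
  also have "\<dots> = (\<Prod>j<m. \<Sum>v\<in>L. ?c v * phase (block z j) v)"
    unfolding S_set_def
    by (rule sum_block_prod[where f = "\<lambda>j v. ?c v * phase (block z j) v"]) (rule L_subset)
  finally show ?thesis .
qed

lemma formally_dual_S'_T':
  "formally_dual_pair (Z2_Z4_power (2 * m)) (canonical_iso (2 * m)) (S' m) (T' m)"
  unfolding formally_dual_pair_def
proof (intro conjI ballI)
  show "T' m \<noteq> {}"
    using card_T'[of m] by force
  fix y assume y: "y \<in> carrier (Z2_Z4_power (2 * m))"
  obtain w z where wz: "y = (w, z)" "w \<in> {0, 1}" "z \<in> carrier (Z4_power (2 * m))"
    using y by (auto simp: carrier_Z2_Z4_power)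
  define B where "B = (if w = 0 then L else L_neg)"
  have local: "(cmod (\<Sum>v\<in>L. (if w = 1 \<and> v = (3, 3) then -1 else 1) * phase (block z j) v))\<^sup>2
      = 4 * real (shift_count L B (block z j))" if "j < m" for j
    using wz(2) L_phase_sum[OF block_in_Z4_square[OF wz(3) that]]
      L_twisted_phase_sum[OF block_in_Z4_square[OF wz(3) that]]
    by (auto simp: B_def)
  have "(cmod (char_sum (canonical_iso (2 * m) y) (S' m)))\<^sup>2
      = (\<Prod>j<m. 4 * real (shift_count L B (block z j)))"
    unfolding wz(1) char_sum_S'[OF wz(2)] prod_norm[symmetric] prod_power_distrib
    by (rule prod.cong) (use local in auto)
  also have "\<dots> = 4 ^ m * (\<Prod>j<m. real (shift_count L B (block z j)))"
    by (simp add: prod.distrib)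
  also have "\<dots> = (real (card (S' m)))\<^sup>2 / real (card (T' m)) *
      real (diff_count (Z2_Z4_power (2 * m)) (T' m) y)"
    unfolding wz(1) diff_count_T'[OF wz(2,3)] card_S' card_T'
    by (simp add: B_def power2_eq_square)
  finally show "(cmod (char_sum (canonical_iso (2 * m) y) (S' m)))\<^sup>2
      = (real (card (S' m)))\<^sup>2 / real (card (T' m)) *
      real (diff_count (Z2_Z4_power (2 * m)) (T' m) y)" .
qed (rule comm_group_Z2_Z4_power finite_Z2_Z4_power canonical_iso_is_iso S'_subset T'_subset)+

lemma block_zero: "j < m \<Longrightarrow> block \<one>\<^bsub>Z4_power (2 * m)\<^esub> j = (0, 0)"
  by (simp add: block_def one_Z4_power)

lemma one_in_block_prod: "(0, 0) \<in> A \<Longrightarrow> \<one>\<^bsub>Z4_power (2 * m)\<^esub> \<in> block_prod m (\<lambda>_. A)"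
  using zero_carrier[of "2 * m"]
  by (simp add: mem_block_prod block_zero) (simp only: one_Z4_power)

lemma block_unit_vec:
  assumes "j < m"
  shows "block (unit_vec (2 * m) i) j
    = (if j = i div 2 then if even i then (1, 0) else (0, 1) else (0, 0))"
  using assms by (auto simp: block_def unit_vec_def elim!: evenE oddE)

lemma unit_vec_in_S_set: "unit_vec (2 * m) i \<in> S_set m"
  by (auto simp: S_set_def mem_block_prod unit_vec_carrier block_unit_vec L_def)

text \<open>Twice a nonzero element of \<open>L\<close> or of \<open>-L\<close> never lies in \<open>L\<close>.\<close>

lemma double_in_block_prod:
  assumes x: "x \<in> carrier (Z4_power (2 * m))" and blocks: "\<And>j. j < m \<Longrightarrow> block x j \<in> L \<union> L_neg"
    and double: "x \<otimes>\<^bsub>Z4_power (2 * m)\<^esub> x \<in> block_prod m (\<lambda>_. L)"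
  shows "x = \<one>\<^bsub>Z4_power (2 * m)\<^esub>"
proof (rule block_prod_eqI[OF x])
  fix j assume j: "j < m"
  have "block (x \<otimes>\<^bsub>Z4_power (2 * m)\<^esub> x) j
      = ((fst (block x j) + fst (block x j)) mod 4, (snd (block x j) + snd (block x j)) mod 4)"
    using j by (simp add: block_def mult_Z4_power)
  moreover have "block (x \<otimes>\<^bsub>Z4_power (2 * m)\<^esub> x) j \<in> L"
    using double j by (simp only: mem_block_prod)
  ultimately have "block x j = (0, 0)"
    by (intro double_L[OF blocks[OF j]]) (simp only:)
  then show "block x j = block \<one>\<^bsub>Z4_power (2 * m)\<^esub> j"
    using j by (simp add: block_zero)
qed (rule monoid.one_closed[OF group.is_monoid[OF group_Z4_power]])

lemma twist_one: "twist m \<one>\<^bsub>Z4_power (2 * m)\<^esub> = 0"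
proof -
  have "{j. j < m \<and> block \<one>\<^bsub>Z4_power (2 * m)\<^esub> j = (3, 3)} = {}"
    by (auto simp: block_zero)
  then show ?thesis unfolding twist_def by (simp only: card.empty)
qed

lemma twist_unit_vec: "twist m (unit_vec (2 * m) i) = 0"
proof -
  have "{j. j < m \<and> block (unit_vec (2 * m) i) j = (3, 3)} = {}"
    by (auto simp: block_unit_vec)
  then show ?thesis unfolding twist_def by (simp only: card.empty)
qed

lemma odd_twist_exists:
  assumes "m \<ge> 1"
  shows "\<exists>x\<in>S_set m. twist m x = 1"
proof
  \<comment> \<open>The vector with blocks \<open>(3, 3), (0, 0), \<dots>, (0, 0)\<close>.\<close>
  let ?x = "\<lambda>i\<in>{..<2 * m}. if i < 2 then 3 else 0 :: int"
  have block: "block ?x j = (if j = 0 then (3, 3) else (0, 0))" if "j < m" for j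
    using that by (auto simp: block_def)
  then have "{j. j < m \<and> block ?x j = (3, 3)} = {0}"
    using assms by (auto split: if_splits)
  then show "twist m ?x = 1"
    unfolding twist_def by (simp only: card.empty card_insert_if) simp
  have "?x \<in> carrier (Z4_power (2 * m))"
    by (auto simp: carrier_Z4_power)
  moreover have "\<forall>j<m. block ?x j \<in> L"
    using block by (simp add: L_def del: restrict_apply)
  ultimately show "?x \<in> S_set m"
    unfolding S_set_def mem_block_prod by blast
qed

lemma primitive_S':
  assumes "m \<ge> 1"
  shows "primitive_subset (Z2_Z4_power (2 * m)) (S' m)"
proof (rule group.primitive_subsetI[OF group_Z2_Z4_power S'_subset])
  let ?G = "Z2_Z4_power (2 * m)"
  have memI: "(int (twist m x mod 2), x) \<in> S' m" if "x \<in> S_set m" for x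
    using that unfolding S'_eq by blast
  show "\<one>\<^bsub>?G\<^esub> \<in> S' m"
    using memI[of "\<one>\<^bsub>Z4_power (2 * m)\<^esub>"] one_in_block_prod[of L m]
    by (simp add: one_Z2_Z4_power S_set_def twist_one L_def)
  show "H = carrier ?G" if H: "subgroup H ?G" "S' m \<subseteq> H" for H
  proof -
    obtain x where "x \<in> S_set m" "twist m x = 1"
      using odd_twist_exists[OF assms] by blast
    then have "(1, x) \<in> H"
      using memI[of x] H(2) by auto
    moreover have "(0, unit_vec (2 * m) i) \<in> H" for i
      using memI[OF unit_vec_in_S_set[of m i]] H(2) by (auto simp: twist_unit_vec)
    ultimately show ?thesis
      using Z2_Z4_power_generated[OF H(1)] by blast
  qed
  fix h assume h: "h \<in> S' m" "h \<noteq> \<one>\<^bsub>?G\<^esub>"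
  then obtain x where x: "x \<in> S_set m" "h = (int (twist m x mod 2), x)"
    unfolding S'_eq by blast
  have "h \<otimes>\<^bsub>?G\<^esub> h \<notin> S' m"
  proof
    assume "h \<otimes>\<^bsub>?G\<^esub> h \<in> S' m"
    then have "x \<otimes>\<^bsub>Z4_power (2 * m)\<^esub> x \<in> block_prod m (\<lambda>_. L)"
      unfolding S'_eq x(2) mult_Z2_Z4_power S_set_def by auto
    with x(1) have "x = \<one>\<^bsub>Z4_power (2 * m)\<^esub>"
      by (intro double_in_block_prod) (auto simp: S_set_def mem_block_prod)
    then show False
      using h(2) x(2) by (simp add: one_Z2_Z4_power twist_one)
  qed
  with h(1) show "\<exists>a\<in>S' m. h \<otimes>\<^bsub>?G\<^esub> a \<notin> S' m" by blast
qed

lemma primitive_T':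
  assumes "m \<ge> 1"
  shows "primitive_subset (Z2_Z4_power (2 * m)) (T' m)"
proof (rule group.primitive_subsetI[OF group_Z2_Z4_power T'_subset])
  let ?G = "Z2_Z4_power (2 * m)" and ?Z = "Z4_power (2 * m)"
  have units: "(0, unit_vec (2 * m) i) \<in> T' m" for i
    using unit_vec_in_S_set[of m i] by (simp add: T'_eq S_set_def)
  show "\<one>\<^bsub>?G\<^esub> \<in> T' m"
    unfolding T'_eq one_Z2_Z4_power using one_in_block_prod[of L m] by (simp add: L_def)
  show "H = carrier ?G" if H: "subgroup H ?G" "T' m \<subseteq> H" for H
  proof -
    have "(1, \<one>\<^bsub>?Z\<^esub>) \<in> T' m"
      unfolding T'_eq using one_in_block_prod[of L_neg m] by (simp add: L_neg_def)
    then show ?thesis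
      using Z2_Z4_power_generated[OF H(1)] units H(2) by blast
  qed
  fix h assume h: "h \<in> T' m" "h \<noteq> \<one>\<^bsub>?G\<^esub>"
  obtain w x where wx: "h = (w, x)" "w \<in> {0, 1}" "x \<in> carrier ?Z" "\<And>j. j < m \<Longrightarrow> block x j \<in> L \<union> L_neg"
    using h(1) by (auto simp: T'_eq mem_block_prod)
  show "\<exists>a\<in>T' m. h \<otimes>\<^bsub>?G\<^esub> a \<notin> T' m"
  proof (cases "x = \<one>\<^bsub>?Z\<^esub>")
    case False
    have "h \<otimes>\<^bsub>?G\<^esub> h \<notin> T' m"
    proof
      assume "h \<otimes>\<^bsub>?G\<^esub> h \<in> T' m"
      then have "x \<otimes>\<^bsub>?Z\<^esub> x \<in> block_prod m (\<lambda>_. L)"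
        using wx(2) unfolding T'_eq wx(1) mult_Z2_Z4_power by auto
      then show False
        using double_in_block_prod[OF wx(3,4)] False by blast
    qed
    then show ?thesis using h(1) by blast
  next
    case True
    \<comment> \<open>Translation by \<open>(1, 0)\<close> moves \<open>e\<^sub>0\<close> to the upper layer, but its first block \<open>(1, 0)\<close> is not
      in \<open>-L\<close>.\<close>
    then have "w = 1"
      using h(2) wx(1,2) by (auto simp: one_Z2_Z4_power)
    let ?a = "(0 :: int, unit_vec (2 * m) 0)"
    have "h \<otimes>\<^bsub>?G\<^esub> ?a = (1, unit_vec (2 * m) 0)"
      using monoid.l_one[OF group.is_monoid[OF group_Z4_power] unit_vec_carrier]
      by (simp add: wx(1) True \<open>w = 1\<close> mult_Z2_Z4_power)
    moreover have "block (unit_vec (2 * m) 0) 0 \<notin> L_neg"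
      using assms by (simp add: block_unit_vec L_neg_def)
    moreover have "0 < m"
      using assms by simp
    ultimately have "h \<otimes>\<^bsub>?G\<^esub> ?a \<notin> T' m"
      unfolding T'_eq by (auto simp only: mem_block_prod Un_iff mem_Sigma_iff singleton_iff)
    then show ?thesis using units by blast
  qed
qed

lemma zero_frequency_T':
  "int (zero_frequency (Z2_Z4_power (2 * m)) (T' m)) = 2 ^ (4 * m + 1) - 13 ^ m - 10 ^ m"
proof -
  let ?G = "Z2_Z4_power (2 * m)"
  let ?U = "\<lambda>B. block_prod m (\<lambda>_. {u \<in> Z4_square. shift_count L B u \<noteq> 0})"
  let ?D = "{0 :: int} \<times> ?U L \<union> {1} \<times> ?U L_neg"
  have mem_U: "z \<in> ?U B \<longleftrightarrow> (\<Prod>j<m. shift_count L B (block z j)) \<noteq> 0"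
    if "z \<in> carrier (Z4_power (2 * m))" for z B
    using that block_in_Z4_square[OF that] by (auto simp: mem_block_prod)
  have D: "?D \<subseteq> carrier ?G"
    using block_prod_subset by (auto simp: carrier_Z2_Z4_power)
  have "card ?D = card (?U L) + card (?U L_neg)"
    by (subst card_Un_disjoint) (auto simp: finite_block_prod card_cartesian_product)
  also have "\<dots> = 13 ^ m + 10 ^ m"
    by (subst (1 2) card_block_prod) (auto simp: card_shift_count_support simp del: neq0_conv)
  finally have cardD: "card ?D = 13 ^ m + 10 ^ m" .
  have cardG: "card (carrier ?G) = 2 * 16 ^ m"
    by (simp add: carrier_Z2_Z4_power card_cartesian_product card_Z4_power power_mult)
  have "{g \<in> carrier ?G. diff_count ?G (T' m) g = 0} = carrier ?G - ?D"
  proof (rule Set.set_eqI)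
    fix g
    show "g \<in> {g \<in> carrier ?G. diff_count ?G (T' m) g = 0} \<longleftrightarrow> g \<in> carrier ?G - ?D"
    proof (cases "g \<in> carrier ?G")
      case True
      then obtain w z where g: "g = (w, z)" "w \<in> {0, 1}" "z \<in> carrier (Z4_power (2 * m))"
        by (auto simp: carrier_Z2_Z4_power)
      have "g \<in> ?D \<longleftrightarrow> z \<in> ?U (if w = 0 then L else L_neg)"
        using g(2) by (auto simp: g(1))
      with True show ?thesis
        unfolding mem_U[OF g(3)] by (simp add: g(1) diff_count_T'[OF g(2,3)])
    qed simp
  qed
  then have "zero_frequency ?G (T' m) = card (carrier ?G) - card ?D"
    unfolding zero_frequency_def
    using D by (simp only: card_Diff_subset[OF finite_subset[OF D finite_Z2_Z4_power] D])
  moreover have "card ?D \<le> card (carrier ?G)"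
    by (rule card_mono[OF finite_Z2_Z4_power D])
  ultimately have "int (zero_frequency ?G (T' m)) = int (2 * 16 ^ m) - int (13 ^ m + 10 ^ m)"
    by (simp only: cardG cardD of_nat_diff)
  then show ?thesis
    by (simp add: power_add power_mult)
qed

theorem theorem6p2:
  fixes m :: nat
  assumes "m \<ge> 1"
  shows "S0 m \<union> S1 m = S_set m \<and> S0 m \<inter> S1 m = {} \<and> S0 m \<noteq> {} \<and> S1 m \<noteq> {} \<and>
    primitive_formally_dual_pair (Z2_Z4_power (2 * m)) (canonical_iso (2 * m)) (S' m) (T' m) \<and>
    int (zero_frequency (Z2_Z4_power (2 * m)) (T' m)) = 2 ^ (4 * m + 1) - 13 ^ m - 10 ^ m"
proof (intro conjI)
  show "S0 m \<union> S1 m = S_set m" "S0 m \<inter> S1 m = {}"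
    unfolding S0_eq S1_eq by blast+
  show "S0 m \<noteq> {}"
    using unit_vec_in_S_set[of m 0] twist_unit_vec[of m 0] unfolding S0_eq by force
  show "S1 m \<noteq> {}"
    using odd_twist_exists[OF assms] unfolding S1_eq by force
  show "primitive_formally_dual_pair (Z2_Z4_power (2 * m)) (canonical_iso (2 * m)) (S' m) (T' m)"
    unfolding primitive_formally_dual_pair_def
    using formally_dual_S'_T' primitive_S'[OF assms] primitive_T'[OF assms] by blast
qed (rule zero_frequency_T')

end
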